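(* Let $k\ge 2$. For every $n\ge 1$, the number $\mathrm{DBW}_k(kn)$ of generalized de Bruijn words of length $kn$ over $\Sigma_k$ equals \[\mathrm{DBW}_k(kn)=((k-1)!)^n\,\kappa(\mathrm{DB}(k,n)).\]
   Context: $\Sigma_k=\{0,1,\ldots,k-1\}$ with its natural order. A necklace is the set of rotations (conjugacy class) of a word. The Burrows–Wheeler matrix of a necklace $[w]$ of length $N$ is the $N\times N$ matrix whose rows are the $N$ rotations of $w$ (with multiplicity) in ascending lexicographic order; $\mathrm{BWT}([w])$ is its last column read top to bottom. A generalized de Bruijn word is a necklace of length $kn$ over $\Sigma_k$ whose BWT is a concatenation of words each of which contains every letter of $\Sigma_k$ exactly once. The generalized de Bruijn graph $\mathrm{DB}(k,n)$ is the directed multigraph with vertex set $\{0,\ldots,n-1\}$ having, for each vertex $m$ and each $i\in\{0,\ldots,k-1\}$, an edge $m\to km+i\bmod n$ (loops and multiple edges allowed). For an Eulerian directed graph $G$, $\kappa(G)$ denotes the number of oriented spanning trees of $G$ directed toward a fixed root vertex (every non-root vertex has outdegree $1$, the root outdegree $0$, no directed cycles); for Eulerian graphs this does not depend on the root and equals the determinant of the Laplacian $D_G-A_G$ with the last row and column removed. *)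

theory Defs
  imports
    Main
    "HOL-Library.List_Lexorder"
    "Graph_Theory.Digraph_Component"
begin

definition necklace :: "'a list \<Rightarrow> 'a list set" where
  "necklace w = {rotate i w | i. True}"

text \<open>
  The order on lists is the lexicographic one. A list of rotations, unlike a set, keeps
  the multiplicities of the rows when the word is not primitive.
\<close>

definition bw_matrix :: "'a::linorder list \<Rightarrow> 'a list list" where
  "bw_matrix w = sort (map (\<lambda>i. rotate i w) [0..<length w])"

text \<open>
  The representative chosen here is irrelevant; see \<open>BWT_necklace\<close> below.
\<close>

definition BWT :: "'a::linorder list set \<Rightarrow> 'a list" where
  "BWT C = map last (bw_matrix (SOME w. w \<in> C))"

lemma bw_matrix_rotate: "bw_matrix (rotate j w) = bw_matrix w"
proof (induction j)
  case (Suc j)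
  have step: "mset (map (\<lambda>i. rotate i (rotate1 v)) [0..<length v]) =
      mset (map (\<lambda>i. rotate i v) [0..<length v])" for v :: "'a list"
  proof (cases "length v")
    case (Suc m)
    have "map (\<lambda>i. rotate i (rotate1 v)) [0..<length v] =
        map (\<lambda>i. rotate i v) (map Suc [0..<length v])"
      by (simp add: rotate1_rotate_swap)
    also have "map Suc [0..<length v] = [Suc 0..<length v] @ [length v]"
      using Suc by (simp add: map_Suc_upt)
    finally have "mset (map (\<lambda>i. rotate i (rotate1 v)) [0..<length v]) =
        mset (map (\<lambda>i. rotate i v) (0 # [Suc 0..<length v]))"
      by simp
    also have "0 # [Suc 0..<length v] = [0..<length v]"
      using Suc by (simp add: upt_conv_Cons)
    finally show ?thesis .
  qed simp
  have "bw_matrix (rotate1 v) = bw_matrix v" for v :: "'a list"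
    unfolding bw_matrix_def length_rotate1
    by (rule properties_for_sort) (simp_all only: step mset_sort sorted_sort)
  then show ?case
    using Suc by simp
qed simp

lemma BWT_necklace: "BWT (necklace w) = map last (bw_matrix w)"
proof -
  have "w \<in> necklace w"
    unfolding necklace_def by (auto intro: exI[of _ 0])
  then have "(SOME v. v \<in> necklace w) \<in> necklace w"
    by (rule someI)
  then show ?thesis
    by (auto simp: BWT_def necklace_def bw_matrix_rotate)
qed

definition generalized_de_bruijn_words :: "nat \<Rightarrow> nat \<Rightarrow> nat list set set" where
  "generalized_de_bruijn_words k N =
    {necklace w | w. length w = N \<and> set w \<subseteq> {0..<k} \<and>
      (\<exists>us. BWT (necklace w) = concat us \<and>
        (\<forall>u\<in>set us. distinct u \<and> set u = {0..<k}))}"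

definition DBW :: "nat \<Rightarrow> nat \<Rightarrow> nat" where
  "DBW k N = card (generalized_de_bruijn_words k N)"

text \<open>
  The arc \<open>(m, i)\<close> goes from \<open>m\<close> to \<open>(k * m + i) mod n\<close>; arcs with different labels
  are different arcs even when they are parallel.
\<close>

definition DB :: "nat \<Rightarrow> nat \<Rightarrow> (nat, nat \<times> nat) pre_digraph" where
  "DB k n = \<lparr>verts = {0..<n}, arcs = {0..<n} \<times> {0..<k},
     tail = fst, head = (\<lambda>(m, i). (k * m + i) mod n)\<rparr>"

text \<open>
  \<^const>\<open>forest\<close> means that there is no directed cycle, loops being cycles of length one.
\<close>

definition oriented_spanning_tree ::
  "('a, 'b) pre_digraph \<Rightarrow> 'a \<Rightarrow> ('a, 'b) pre_digraph \<Rightarrow> bool" where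
  "oriented_spanning_tree G r T \<longleftrightarrow>
     spanning T G \<and>
     out_degree T r = 0 \<and>
     (\<forall>v\<in>verts G - {r}. out_degree T v = 1) \<and>
     forest T"

text \<open>
  A subgraph has the same tail and head functions as the ambient graph, so distinct
  \<open>T\<close> below have distinct arc sets.
\<close>

definition kappa :: "('a, 'b) pre_digraph \<Rightarrow> 'a \<Rightarrow> nat" where
  "kappa G r = card {T. oriented_spanning_tree G r T}"

end

theory Submission
  imports Defs "HOL-Combinatorics.Multiset_Permutations"
begin

text \<open>
  Number the arc \<open>(m, i)\<close> of the de Bruijn graph by \<open>x = k * m + i\<close>: its tail is \<open>x div k\<close> and,
  since \<open>head = x mod n\<close>, an Eulerian circuit is a cyclic arrangement of the numbers below \<open>k * n\<close>
  in which \<open>x\<close> is followed by some \<open>y\<close> with \<open>x mod n = y div k\<close>. This is the inverse of the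
  standard permutation of a concatenation of \<open>n\<close> permutations of the alphabet: reading \<open>x div n\<close>
  along the circuit gives the word, and \<open>x\<close> itself is the row of the rotation read from there.
  So generalized de Bruijn words correspond to Eulerian circuits, which the BEST theorem counts.
\<close>

section \<open>The BEST theorem\<close>

text \<open>The factor \<open>((k-1)!)^n\<close> comes from the orders in which a circuit uses the
  \<open>k\<close> arcs leaving each vertex. At the root the first arc is prescribed; at any other
  vertex the last one is, since the last exits form a tree directed to the root. Either way
  \<open>k - 1\<close> arcs remain free. Prescribing the first arc also removes the choice of a
  representative of the necklace. The passage to words needs the rows of the matrix to be pairwise
  distinct, so that a rotation has one well-defined row. For a circuit this is arithmetic: if
  \<open>x < y\<close> have the same quotient by \<open>n\<close>, then
  \<open>x mod n < y mod n\<close>, and these are the quotients by \<open>k\<close> of the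
  successors, so a tie between letters hands the strict inequality on. For a word it rests on
  \<open>k \<ge> 2\<close>: two equal rotations would double the least row and so repeat a letter in
  the first block of the last column.\<close>

lemma (in wf_digraph) forest_iff_acyclic: "forest G \<longleftrightarrow> acyclic (arcs_ends G)"
proof -
  have "(\<exists>p. cycle p) \<longleftrightarrow> (\<exists>u. u \<rightarrow>\<^sup>+\<^bsub>G\<^esub> u)"
    using closed_w_imp_cycle
    by (auto simp: cycle_def closed_w_def reachable1_awalk)
  then show ?thesis
    by (simp add: forest_def acyclic_def)
qed

section \<open>Walks and the order of exits at each vertex\<close>

context pre_digraph
begin

text \<open>The current vertex and the first entry of its exit list determine the next arc; removing
  this arc from both walks keeps all exit lists equal.\<close>

lemma cas_filter_inj:
  assumes "cas u p v" "cas u q w"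
    and "\<And>x. filter (\<lambda>a. tail G a = x) p = filter (\<lambda>a. tail G a = x) q"
  shows "p = q"
  using assms
proof (induction p arbitrary: u q)
  case Nil
  have "q = []"
  proof (rule ccontr)
    assume "q \<noteq> []"
    with Nil.prems(3)[of "tail G (hd q)"] show False
      by (cases q) auto
  qed
  then show ?case by simp
next
  case (Cons a p)
  from Cons.prems(1) have u: "tail G a = u" and p: "cas (head G a) p v"
    by auto
  have *: "filter (\<lambda>a. tail G a = u) q = a # filter (\<lambda>a. tail G a = u) p"
    using Cons.prems(3)[of u] u by simp
  then obtain b q' where q: "q = b # q'"
    by (cases q) auto
  with Cons.prems(2) * have "b = a"
    by auto
  have "p = q'"
  proof (rule Cons.IH[OF p])
    show "cas (head G a) q' w"
      using Cons.prems(2) q \<open>b = a\<close> by simp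
    show "filter (\<lambda>a. tail G a = x) p = filter (\<lambda>a. tail G a = x) q'" for x
      using Cons.prems(3)[of x] q \<open>b = a\<close> by (simp split: if_splits)
  qed
  with q \<open>b = a\<close> show ?case by simp
qed

text \<open>Each arc of a walk enters the vertex that the next arc leaves; only the two ends are
  unmatched.\<close>

lemma cas_balance:
  assumes "cas u p v"
  shows "length (filter (\<lambda>a. head G a = x) p) + (if x = u then 1 else 0) =
    length (filter (\<lambda>a. tail G a = x) p) + (if x = v then 1 else 0)"
  using assms by (induction p arbitrary: u) (fastforce split: if_splits)+

lemma cas_head_in_tails:
  assumes "cas u p v" "a \<in> set p" "head G a \<noteq> v"
  shows "head G a \<in> tail G ` set p"
  using assms
proof (induction p arbitrary: u)
  case (Cons b p)
  then show ?case by (cases p) auto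
qed simp

text \<open>After its last exit from \<open>v\<close> the walk enters a vertex that is
  \<open>r\<close> or is left once more later, so the times of last exits increase along the
  relation. The induction prepends an arc: either no last exit changes, or the new pair starts at a
  vertex that no pair points to.\<close>

lemma acyclic_last_exits:
  assumes "cas u p r"
  shows "acyclic ((\<lambda>v. (v, head G (last (filter (\<lambda>a. tail G a = v) p)))) ` (tail G ` set p - {r}))"
    (is "acyclic (?R p)")
  using assms
proof (induction p arbitrary: u)
  case Nil
  then show ?case by (simp add: acyclic_def)
next
  case (Cons a p)
  let ?v = "tail G a" and ?w = "head G a"
  have p: "cas ?w p r"
    using Cons.prems by simp
  note IH = Cons.IH[OF p]
  have same: "last (filter (\<lambda>b. tail G b = x) (a # p)) = last (filter (\<lambda>b. tail G b = x) p)"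
    if "x \<in> tail G ` set p" for x
    using that by (auto simp: filter_empty_conv)
  show ?case
  proof (cases "?v = r \<or> ?v \<in> tail G ` set p")
    case True
    then have "tail G ` set (a # p) - {r} = tail G ` set p - {r}"
      by auto
    then have "?R (a # p) = ?R p"
      using same by (intro image_cong) auto
    with IH show ?thesis by simp
  next
    case False
    then have *: "tail G ` set (a # p) - {r} = insert ?v (tail G ` set p - {r})"
      by auto
    have "filter (\<lambda>b. tail G b = ?v) p = []"
      using False image_iff by (fastforce simp: filter_empty_conv)
    then have "?R (a # p) = insert (?v, ?w) ((\<lambda>v. (v, head G (last (filter (\<lambda>b. tail G b = v) (a # p)))))
        ` (tail G ` set p - {r}))"
      unfolding * by simp
    also have "\<dots> = insert (?v, ?w) (?R p)"
      using same by (intro arg_cong[where f = "insert _"] image_cong) auto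
    finally have R: "?R (a # p) = insert (?v, ?w) (?R p)" .
    have "?w \<noteq> ?v"
      using p False by (cases p) auto
    \<comment> \<open>A vertex other than \<open>r\<close> that \<open>p\<close> enters is also left
      by \<open>p\<close>, whereas \<open>p\<close> never leaves \<open>?v\<close>.\<close>
    moreover have "?v \<notin> Range (?R p)"
    proof
      assume "?v \<in> Range (?R p)"
      then obtain x where x: "x \<in> tail G ` set p" "?v = head G (last (filter (\<lambda>b. tail G b = x) p))"
        by auto
      then have "filter (\<lambda>b. tail G b = x) p \<noteq> []"
        by (auto simp: filter_empty_conv)
      from last_in_set[OF this] x(2) have "?v \<in> tail G ` set p"
        using cas_head_in_tails[OF p] False by auto
      with False show False by simp
    qed
    ultimately have "(?w, ?v) \<notin> (?R p)\<^sup>*"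
      by (blast elim: rtranclE)
    with IH R show ?thesis
      by (simp add: acyclic_insert)
  qed
qed

end

section \<open>Eulerian circuits and exit orders\<close>

context fin_digraph
begin

text \<open>An arc \<open>e\<close> of the digraph occurs exactly once in a circuit, so pinning it
  in front selects one list from each rotation class.\<close>

definition euler_circuits :: "'b \<Rightarrow> 'b list set" where
  "euler_circuits e =
    {p. trail (tail G e) p (tail G e) \<and> set p = arcs G \<and> hd p = e}"

definition exits :: "'b list \<Rightarrow> 'a \<Rightarrow> 'b list" where
  "exits p = (\<lambda>v\<in>verts G. filter (\<lambda>a. tail G a = v) p)"

text \<open>This will be the image of \<open>exits\<close>. Acyclicity is exactly what keeps a
  greedy walk along these orders from returning to its start for good while arcs are left
  over.\<close>

definition exit_orders :: "'b \<Rightarrow> ('a \<Rightarrow> 'b list) set" where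
  "exit_orders e = {g \<in> (\<Pi>\<^sub>E v\<in>verts G. permutations_of_set (out_arcs G v)). hd (g (tail G e)) = e \<and>
    acyclic ((\<lambda>v. (v, head G (last (g v)))) ` (verts G - {tail G e}))}"

lemma exits_in_exit_orders:
  assumes "e \<in> arcs G" "\<And>v. v \<in> verts G \<Longrightarrow> out_arcs G v \<noteq> {}" "p \<in> euler_circuits e"
  shows "exits p \<in> exit_orders e"
proof -
  let ?r = "tail G e"
  have p: "cas ?r p ?r" "distinct p" "set p = arcs G" "hd p = e"
    using assms(3) by (auto simp: euler_circuits_def trail_def awalk_def)
  then obtain p' where p': "p = e # p'"
    using assms(1) by (cases p) auto
  \<comment> \<open>\<open>acyclic_last_exits\<close> speaks of the vertices that \<open>p\<close>
    leaves; here these are all vertices, so the last exits span.\<close>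
  have tails: "tail G ` set p = verts G"
  proof
    show "tail G ` set p \<subseteq> verts G"
      using p(3) by auto
    show "verts G \<subseteq> tail G ` set p"
    proof
      fix v assume "v \<in> verts G"
      with assms(2) obtain a where "a \<in> out_arcs G v"
        by blast
      then show "v \<in> tail G ` set p"
        using p(3) by auto
    qed
  qed
  have "acyclic ((\<lambda>v. (v, head G (last (exits p v)))) ` (verts G - {?r}))"
    using acyclic_last_exits[OF p(1)] unfolding tails
    by (simp add: exits_def cong: image_cong_simp)
  moreover have "hd (exits p ?r) = e"
    using p' assms(1) by (simp add: exits_def)
  moreover have "exits p \<in> (\<Pi>\<^sub>E v\<in>verts G. permutations_of_set (out_arcs G v))"
    using p(2,3) by (auto simp: exits_def permutations_of_set_def)
  ultimately show ?thesis
    by (simp add: exit_orders_def)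
qed

lemma inj_on_exits: "inj_on exits (euler_circuits e)"
proof (rule inj_onI)
  fix p q assume pq: "p \<in> euler_circuits e" "q \<in> euler_circuits e" "exits p = exits q"
  have c: "cas (tail G e) p (tail G e)" "cas (tail G e) q (tail G e)"
    "set p = arcs G" "set q = arcs G"
    using pq(1,2) by (auto simp: euler_circuits_def trail_def awalk_def)
  show "p = q"
  proof (rule cas_filter_inj[OF c(1,2)])
    fix x
    show "filter (\<lambda>a. tail G a = x) p = filter (\<lambda>a. tail G a = x) q"
    proof (cases "x \<in> verts G")
      case True
      with fun_cong[OF pq(3), of x] show ?thesis
        by (simp add: exits_def)
    next
      case False
      with c(3,4) have "\<forall>a\<in>set p \<union> set q. tail G a \<noteq> x"
        by auto
      then show ?thesis
        by (simp add: filter_empty_conv)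
    qed
  qed
qed

text \<open>
  Following the prescribed exits greedily, a balanced digraph lets the walk get stuck only at
  its start. An arc left over would start a path of unused last exits, which by acyclicity
  reaches the start; but there every incoming arc has been used.
\<close>

lemma exit_orders_subset_exits:
  assumes e: "e \<in> arcs G" and ne: "\<And>v. v \<in> verts G \<Longrightarrow> out_arcs G v \<noteq> {}"
    and bal: "\<And>v. v \<in> verts G \<Longrightarrow> in_degree G v = out_degree G v"
    and g: "g \<in> exit_orders e"
  shows "\<exists>p\<in>euler_circuits e. exits p = g"
proof -
  let ?r = "tail G e"
  have g_PiE: "g \<in> (\<Pi>\<^sub>E v\<in>verts G. permutations_of_set (out_arcs G v))"
    and hd_g: "hd (g ?r) = e"
    and acyc: "acyclic ((\<lambda>v. (v, head G (last (g v)))) ` (verts G - {?r}))"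
    using g by (auto simp: exit_orders_def)
  have g_out: "distinct (g v)" "set (g v) = out_arcs G v" if "v \<in> verts G" for v
    using PiE_mem[OF g_PiE that] by (auto simp: permutations_of_set_def)
  have r: "?r \<in> verts G"
    using e by simp
  \<comment> \<open>Greedy runs without recursion: a walk from the root whose exits at each vertex
    are an initial segment of the prescribed order. A longest such walk takes the place of the
    finished run.\<close>
  define W where "W p \<longleftrightarrow> set p \<subseteq> arcs G \<and> (\<exists>x. cas ?r p x) \<and>
    (\<forall>v\<in>verts G. \<exists>zs. g v = filter (\<lambda>a. tail G a = v) p @ zs)" for p
  \<comment> \<open>A repeated arc would be repeated in the exit list of its tail, a prefix of a
    distinct list. This bounds the length, so a longest walk exists.\<close>
  have W_dist: "distinct p" if "W p" for p
  proof (rule ccontr)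
    assume "\<not> distinct p"
    then obtain xs a ys zs where a: "p = xs @ [a] @ ys @ [a] @ zs"
      using not_distinct_decomp by blast
    with that have "a \<in> arcs G"
      by (simp add: W_def)
    then have v: "tail G a \<in> verts G"
      by simp
    with that obtain us where "g (tail G a) = filter (\<lambda>b. tail G b = tail G a) p @ us"
      by (auto simp: W_def)
    with g_out(1)[OF v] show False
      by (simp add: a)
  qed
  have "W []"
    by (simp add: W_def)
  moreover have "\<forall>p. W p \<longrightarrow> length p < Suc (card (arcs G))"
    using W_dist by (metis W_def card_mono distinct_card finite_arcs less_Suc_eq_le)
  ultimately obtain p where p: "W p" and max: "\<And>q. W q \<Longrightarrow> length q \<le> length p"
    using ex_has_greatest_nat[of W "[]" length] by metis
  obtain x where x: "cas ?r p x" and sub: "set p \<subseteq> arcs G" and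
    pre: "\<And>v. v \<in> verts G \<Longrightarrow> \<exists>zs. g v = filter (\<lambda>a. tail G a = v) p @ zs"
    using p by (auto simp: W_def)
  have dist: "distinct p"
    by (rule W_dist[OF p])
  have x_vert: "x \<in> verts G"
    using x sub r by (metis awalk_def awalk_last_in_verts)
  have stuck: "g x = filter (\<lambda>a. tail G a = x) p"
  proof (rule ccontr)
    assume *: "g x \<noteq> filter (\<lambda>a. tail G a = x) p"
    with pre[OF x_vert] obtain a zs where a: "g x = filter (\<lambda>a. tail G a = x) p @ a # zs"
      by (metis append_Nil2 neq_Nil_conv)
    then have "a \<in> out_arcs G x"
      using g_out(2)[OF x_vert] by (metis in_set_conv_decomp)
    then have "cas ?r (p @ [a]) (head G a)"
      using x by (simp add: awlast_if_cas[OF x])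
    moreover have "\<exists>us. g v = filter (\<lambda>b. tail G b = v) (p @ [a]) @ us" if "v \<in> verts G" for v
      using pre[OF that] a \<open>a \<in> out_arcs G x\<close> by auto
    ultimately have "W (p @ [a])"
      using sub \<open>a \<in> out_arcs G x\<close> unfolding W_def by auto
    from max[OF this] show False by simp
  qed
  have heads: "length (filter (\<lambda>a. head G a = v) p) \<le> in_degree G v"
    and tails: "length (filter (\<lambda>a. tail G a = v) p) \<le> out_degree G v" for v
    using dist sub unfolding in_degree_def out_degree_def
    by (auto simp: distinct_length_filter intro!: card_mono)
  have full_in: "in_arcs G v \<subseteq> set p" if "length (filter (\<lambda>a. head G a = v) p) = in_degree G v" for v
  proof -
    have "set p \<inter> {a. head G a = v} = in_arcs G v"
      using that sub dist by (intro card_subset_eq)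
        (auto simp: distinct_length_filter in_degree_def Int_commute)
    then show ?thesis by blast
  qed
  have stuck_len: "length (filter (\<lambda>a. tail G a = x) p) = out_degree G x"
    using g_out[OF x_vert] stuck by (metis distinct_card out_degree_def)
  have "x = ?r"
    using cas_balance[OF x, of x] stuck_len heads[of x] bal[OF x_vert] by (auto split: if_splits)
  note x = x[unfolded \<open>x = ?r\<close>] and stuck = stuck[unfolded \<open>x = ?r\<close>]
    and stuck_len = stuck_len[unfolded \<open>x = ?r\<close>]
  have flow: "length (filter (\<lambda>a. head G a = v) p) = length (filter (\<lambda>a. tail G a = v) p)" for v
    using cas_balance[OF x, of v] by (simp split: if_splits)
  have in_r: "in_arcs G ?r \<subseteq> set p"
    using flow[of ?r] stuck_len bal[OF r] by (intro full_in) simp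
  have step: "head G (last (g v)) \<in> verts G - {?r} \<and> \<not> out_arcs G (head G (last (g v))) \<subseteq> set p"
    if v: "v \<in> verts G" "v \<noteq> ?r" "\<not> out_arcs G v \<subseteq> set p" for v
  proof -
    let ?a = "last (g v)"
    have gv: "g v \<noteq> []"
      using ne[OF v(1)] g_out(2)[OF v(1)] by auto
    then have a: "?a \<in> out_arcs G v"
      using g_out(2)[OF v(1)] last_in_set by blast
    obtain zs where zs: "g v = filter (\<lambda>a. tail G a = v) p @ zs"
      using pre[OF v(1)] by blast
    have "zs \<noteq> []"
    proof
      assume "zs = []"
      with zs have "out_arcs G v \<subseteq> set p"
        using g_out(2)[OF v(1)] by auto
      with v(3) show False by contradiction
    qed
    then have "?a \<in> set zs"
      using zs by simp
    then have "?a \<notin> set p"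
      using zs g_out(1)[OF v(1)] a by auto
    then have *: "\<not> in_arcs G (head G ?a) \<subseteq> set p"
      using a by auto
    then have "head G ?a \<noteq> ?r"
      using in_r by auto
    moreover have w: "head G ?a \<in> verts G"
      using a by auto
    moreover have "\<not> out_arcs G (head G ?a) \<subseteq> set p"
    proof
      assume "out_arcs G (head G ?a) \<subseteq> set p"
      then have "out_degree G (head G ?a) \<le> length (filter (\<lambda>b. tail G b = head G ?a) p)"
        unfolding out_degree_def using dist
        by (auto simp: distinct_length_filter intro!: card_mono)
      with tails flow bal[OF w] have "in_arcs G (head G ?a) \<subseteq> set p"
        by (intro full_in) (metis le_antisym)
      with * show False by contradiction
    qed
    ultimately show ?thesis by simp
  qed
  have all_out: "out_arcs G v \<subseteq> set p" if "v \<in> verts G" for v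
  proof (rule ccontr)
    assume **: "\<not> out_arcs G v \<subseteq> set p"
    let ?R = "(\<lambda>v. (v, head G (last (g v)))) ` (verts G - {?r})"
    let ?U = "{v \<in> verts G - {?r}. \<not> out_arcs G v \<subseteq> set p}"
    have "out_arcs G ?r \<subseteq> set p"
      using stuck g_out(2)[OF r] by auto
    with that ** have "v \<in> ?U" by auto
    moreover have "wf (?R\<inverse>)"
      using acyc by (intro finite_acyclic_wf_converse) auto
    ultimately obtain z where z: "z \<in> ?U" "\<And>y. (y, z) \<in> ?R\<inverse> \<Longrightarrow> y \<notin> ?U"
      using wfE_min[of "?R\<inverse>" v ?U] by blast
    with step[of z] show False
      by auto
  qed
  have "set p = arcs G"
  proof
    show "arcs G \<subseteq> set p"
    proof
      fix a assume "a \<in> arcs G"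
      with all_out[of "tail G a"] show "a \<in> set p" by auto
    qed
  qed (rule sub)
  moreover have "hd p = e"
  proof -
    obtain a p' where "p = a # p'"
      using \<open>set p = arcs G\<close> e by (cases p) auto
    then show ?thesis
      using stuck hd_g x by simp
  qed
  ultimately have "p \<in> euler_circuits e"
    using x dist r by (simp add: euler_circuits_def trail_def awalk_def)
  moreover have "exits p = g"
  proof
    fix v
    show "exits p v = g v"
    proof (cases "v \<in> verts G")
      case True
      then obtain zs where zs: "g v = filter (\<lambda>a. tail G a = v) p @ zs"
        using pre by blast
      have "zs = []"
      proof (rule ccontr)
        assume "zs \<noteq> []"
        then have l: "last zs \<in> set zs" by simp
        then have "last zs \<in> set (g v)"
          using zs by simp
        then have "last zs \<in> set (filter (\<lambda>a. tail G a = v) p)"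
          using g_out(2)[OF True] \<open>set p = arcs G\<close> by simp
        then show False
          using g_out(1)[OF True] l zs by (auto simp del: set_filter)
      qed
      then show ?thesis
        using zs True by (simp add: exits_def)
    next
      case False
      then show ?thesis
        using PiE_arb[OF g_PiE] by (simp add: exits_def)
    qed
  qed
  ultimately show ?thesis by blast
qed

lemma bij_betw_exits:
  assumes "e \<in> arcs G" "\<And>v. v \<in> verts G \<Longrightarrow> out_arcs G v \<noteq> {}"
    "\<And>v. v \<in> verts G \<Longrightarrow> in_degree G v = out_degree G v"
  shows "bij_betw exits (euler_circuits e) (exit_orders e)"
  using exits_in_exit_orders[OF assms(1,2)] exit_orders_subset_exits[OF assms] inj_on_exits
  unfolding bij_betw_def by blast

end

section \<open>Counting exit orders by spanning trees\<close>

lemma card_permutations_of_set_last: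
  assumes "finite A" "a \<in> A"
  shows "card {xs \<in> permutations_of_set A. last xs = a} = fact (card A - 1)"
proof -
  have "{xs \<in> permutations_of_set A. last xs = a} = (\<lambda>xs. xs @ [a]) ` permutations_of_set (A - {a})"
  proof (intro equalityI subsetI)
    fix xs assume xs: "xs \<in> {xs \<in> permutations_of_set A. last xs = a}"
    with assms(2) have "xs \<noteq> []"
      by (auto simp: permutations_of_set_def)
    with xs obtain ys where "xs = ys @ [a]"
      by (cases xs rule: rev_cases) auto
    with xs show "xs \<in> (\<lambda>xs. xs @ [a]) ` permutations_of_set (A - {a})"
      by (auto simp: permutations_of_set_def)
  next
    fix xs assume "xs \<in> (\<lambda>xs. xs @ [a]) ` permutations_of_set (A - {a})"
    then obtain ys where ys: "xs = ys @ [a]" "set ys = A - {a}" "distinct ys"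
      by (auto simp: permutations_of_set_def)
    then have "set xs = A"
      using assms(2) insert_Diff[of a A] by simp
    with ys show "xs \<in> {xs \<in> permutations_of_set A. last xs = a}"
      by (simp add: permutations_of_set_def)
  qed
  then show ?thesis
    using assms by (simp add: card_image inj_on_def)
qed

lemma card_permutations_of_set_hd:
  assumes "finite A" "a \<in> A"
  shows "card {xs \<in> permutations_of_set A. hd xs = a} = fact (card A - 1)"
proof -
  have ne: "xs \<noteq> []" if "xs \<in> permutations_of_set A" for xs
    using that assms(2) by (auto simp: permutations_of_set_def)
  have "bij_betw rev {xs \<in> permutations_of_set A. last xs = a} {xs \<in> permutations_of_set A. hd xs = a}"
    by (rule bij_betwI[where g = rev])
      (use ne in \<open>auto simp: permutations_of_set_def hd_rev last_rev\<close>)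
  then show ?thesis
    using card_permutations_of_set_last[OF assms] by (simp add: bij_betw_same_card)
qed

context fin_digraph
begin

definition exit_trees :: "'a \<Rightarrow> ('a \<Rightarrow> 'b) set" where
  "exit_trees r = {t \<in> \<Pi>\<^sub>E v\<in>verts G - {r}. out_arcs G v.
    acyclic ((\<lambda>v. (v, head G (t v))) ` (verts G - {r}))}"

lemma finite_exit_trees: "finite (exit_trees r)"
proof (rule finite_subset)
  show "finite (\<Pi>\<^sub>E v\<in>verts G - {r}. out_arcs G v)"
    by (intro finite_PiE) auto
qed (auto simp: exit_trees_def)

text \<open>Out-degree one away from \<open>r\<close> and zero at \<open>r\<close> make the arc set
  of a tree the image of a unique choice function, and \<open>forest_iff_acyclic\<close> matches the
  two conditions on cycles.\<close>

lemma kappa_eq_card_exit_trees: "kappa G r = card (exit_trees r)"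
proof -
  let ?S = "verts G - {r}"
  let ?T = "\<lambda>t. G\<lparr>arcs := t ` ?S\<rparr>"
  have wf: "wf_digraph (?T t)" and ends: "arcs_ends (?T t) = (\<lambda>v. (v, head G (t v))) ` ?S"
    if "t \<in> (\<Pi>\<^sub>E v\<in>?S. out_arcs G v)" for t
  proof -
    have *: "t v \<in> arcs G \<and> tail G (t v) = v" if "v \<in> ?S" for v
      using PiE_mem[OF \<open>t \<in> _\<close> that] by simp
    show "wf_digraph (?T t)"
    proof
      fix a assume "a \<in> arcs (?T t)"
      with * have "a \<in> arcs G"
        by auto
      then show "tail (?T t) a \<in> verts (?T t)" "head (?T t) a \<in> verts (?T t)"
        by simp_all
    qed
    show "arcs_ends (?T t) = (\<lambda>v. (v, head G (t v))) ` ?S"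
      unfolding arcs_ends_def arc_to_ends_def using * by (auto simp: image_image intro!: image_cong)
  qed
  have out: "out_arcs (?T t) v = (if v \<in> ?S then {t v} else {})"
    if "t \<in> (\<Pi>\<^sub>E v\<in>?S. out_arcs G v)" for t v
  proof -
    have *: "t v \<in> arcs G \<and> tail G (t v) = v" if "v \<in> ?S" for v
      using PiE_mem[OF \<open>t \<in> _\<close> that] by simp
    show ?thesis
    proof (intro equalityI subsetI)
      fix a assume "a \<in> out_arcs (?T t) v"
      then obtain w where "w \<in> ?S" "a = t w" "tail G a = v"
        by (auto simp: out_arcs_def)
      with *[of w] show "a \<in> (if v \<in> ?S then {t v} else {})"
        by auto
    next
      fix a assume "a \<in> (if v \<in> ?S then {t v} else {})"
      then have "v \<in> ?S" "a = t v"
        by (auto split: if_splits)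
      with *[of v] show "a \<in> out_arcs (?T t) v"
        by (auto simp: out_arcs_def)
    qed
  qed
  have "bij_betw ?T (exit_trees r) {T. oriented_spanning_tree G r T}"
    unfolding bij_betw_def
  proof (intro conjI inj_onI equalityI subsetI)
    fix t t' assume t: "t \<in> exit_trees r" "t' \<in> exit_trees r" "?T t = ?T t'"
    have "t v = t' v" if "v \<in> ?S" for v
      using out[of t v] out[of t' v] t that by (auto simp: exit_trees_def)
    then show "t = t'"
      using t(1,2) by (intro PiE_ext[of t _ _ t']) (auto simp: exit_trees_def)
  next
    fix T assume "T \<in> ?T ` exit_trees r"
    then obtain t where t: "t \<in> exit_trees r" and T: "T = ?T t"
      by blast
    then have tP: "t \<in> (\<Pi>\<^sub>E v\<in>?S. out_arcs G v)" and ac: "acyclic (arcs_ends (?T t))"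
      using ends[of t] by (auto simp: exit_trees_def)
    have "t ` ?S \<subseteq> arcs G"
      using PiE_mem[OF tP] by auto
    then have "spanning (?T t) G"
      using wf[OF tP] wf_digraph_axioms
      by (auto simp: spanning_def subgraph_def compatible_def)
    moreover have "forest (?T t)"
      using wf_digraph.forest_iff_acyclic[OF wf[OF tP]] ac by simp
    ultimately show "T \<in> {T. oriented_spanning_tree G r T}"
      using out[OF tP] by (auto simp: T oriented_spanning_tree_def out_degree_def)
  next
    fix T assume "T \<in> {T. oriented_spanning_tree G r T}"
    then have sp: "spanning T G" and out_r: "out_degree T r = 0"
      and out_v: "\<And>v. v \<in> ?S \<Longrightarrow> out_degree T v = 1" and fo: "forest T"
      by (auto simp: oriented_spanning_tree_def)
    have T_sub: "verts T = verts G" "arcs T \<subseteq> arcs G" "tail T = tail G" "head T = head G" "wf_digraph T"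
      using sp by (auto simp: spanning_def subgraph_def compatible_def)
    \<comment> \<open>\<open>out_degree\<close> is a cardinality, and \<open>card\<close> is also 0
      on infinite sets: degree 0 at \<open>r\<close> excludes arcs only by finiteness.\<close>
    then have "finite (out_arcs T v)" for v
      by (auto simp: out_arcs_def intro: finite_subset[OF _ finite_arcs])
    with out_r have no_r: "tail G a \<noteq> r" if "a \<in> arcs T" for a
      using that T_sub(3) by (auto simp: out_degree_def)
    define t where "t = (\<lambda>v\<in>?S. the_elem (out_arcs T v))"
    have t: "out_arcs T v = {t v}" if "v \<in> ?S" for v
    proof -
      have "card (out_arcs T v) = 1"
        using out_v[OF that] by (simp add: out_degree_def)
      then obtain a where "out_arcs T v = {a}"
        by (rule card_1_singletonE)
      with that show ?thesis
        by (simp add: t_def)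
    qed
    have tP: "t \<in> (\<Pi>\<^sub>E v\<in>?S. out_arcs G v)"
    proof (rule PiE_I)
      fix v assume "v \<in> ?S"
      with t[OF this] T_sub show "t v \<in> out_arcs G v"
        by (auto simp: out_arcs_def)
    qed (auto simp: t_def)
    have "arcs T = t ` ?S"
    proof (intro equalityI subsetI)
      fix a assume a: "a \<in> arcs T"
      then have "tail G a \<in> ?S"
        using no_r T_sub(2) by auto
      with t[OF this] a T_sub(3) show "a \<in> t ` ?S"
        by (auto simp: out_arcs_def)
    next
      fix a assume "a \<in> t ` ?S"
      with t show "a \<in> arcs T"
        by (auto simp: out_arcs_def)
    qed
    with T_sub have T: "T = ?T t"
      by simp
    moreover have "t \<in> exit_trees r"
      using tP ends[OF tP] fo wf_digraph.forest_iff_acyclic[OF T_sub(5)]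
      unfolding exit_trees_def T by simp
    ultimately show "T \<in> ?T ` exit_trees r"
      by blast
  qed
  then show ?thesis
    by (simp add: kappa_def bij_betw_same_card)
qed

text \<open>The exit orders split into the fibres \<open>F t\<close> over their trees
  \<open>t\<close> of last exits. A fibre is a product of independent choices, each a permutation
  with one end fixed: the first entry at the root, the last entry elsewhere. All fibres have the
  same size.\<close>

lemma card_exit_orders:
  assumes e: "e \<in> arcs G" and ne: "\<And>v. v \<in> verts G \<Longrightarrow> out_arcs G v \<noteq> {}"
  shows "card (exit_orders e) = kappa G (tail G e) * (\<Prod>v\<in>verts G. fact (out_degree G v - 1))"
proof -
  let ?r = "tail G e"
  define F where "F t = (\<Pi>\<^sub>E v\<in>verts G. if v = ?r then {xs \<in> permutations_of_set (out_arcs G v). hd xs = e}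
    else {xs \<in> permutations_of_set (out_arcs G v). last xs = t v})" for t
  have r: "?r \<in> verts G"
    using e by simp
  have "exit_orders e = (\<Union>t\<in>exit_trees ?r. F t)"
  proof (intro equalityI subsetI)
    fix g assume g: "g \<in> exit_orders e"
    define t where "t = (\<lambda>v\<in>verts G - {?r}. last (g v))"
    have g_perm: "g v \<in> permutations_of_set (out_arcs G v)" if "v \<in> verts G" for v
      using g that by (auto simp: exit_orders_def)
    have "last (g v) \<in> out_arcs G v" if "v \<in> verts G" for v
      using g_perm[OF that] ne[OF that] last_in_set[of "g v"]
      by (metis permutations_of_setD(1) set_empty)
    moreover have "(\<lambda>v. (v, head G (t v))) ` (verts G - {?r}) =
        (\<lambda>v. (v, head G (last (g v)))) ` (verts G - {?r})"
      by (intro image_cong) (auto simp: t_def)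
    ultimately have "t \<in> exit_trees ?r"
      using g by (auto simp: exit_trees_def exit_orders_def t_def simp del: in_out_arcs_conv)
    moreover have "g \<in> F t"
      using g g_perm by (auto simp: F_def t_def exit_orders_def PiE_iff)
    ultimately show "g \<in> (\<Union>t\<in>exit_trees ?r. F t)"
      by blast
  next
    fix g assume "g \<in> (\<Union>t\<in>exit_trees ?r. F t)"
    then obtain t where t: "t \<in> exit_trees ?r" "g \<in> F t"
      by blast
    have g: "g v \<in> permutations_of_set (out_arcs G v)" "v = ?r \<Longrightarrow> hd (g v) = e"
      "v \<noteq> ?r \<Longrightarrow> last (g v) = t v" if "v \<in> verts G" for v
      using PiE_mem[OF t(2)[unfolded F_def] that] by (auto split: if_splits)
    have "(\<lambda>v. (v, head G (t v))) ` (verts G - {?r}) =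
        (\<lambda>v. (v, head G (last (g v)))) ` (verts G - {?r})"
      using g by (intro image_cong) auto
    then show "g \<in> exit_orders e"
      using t g r by (auto simp: exit_orders_def exit_trees_def F_def PiE_iff)
  qed
  also have "card \<dots> = (\<Sum>t\<in>exit_trees ?r. card (F t))"
  proof (rule card_UN_disjoint)
    show "\<forall>t\<in>exit_trees ?r. finite (F t)"
      by (auto simp: F_def intro!: finite_PiE)
    show "\<forall>t\<in>exit_trees ?r. \<forall>t'\<in>exit_trees ?r. t \<noteq> t' \<longrightarrow> F t \<inter> F t' = {}"
    proof (intro ballI impI equals0I)
      fix t t' g assume *: "t \<in> exit_trees ?r" "t' \<in> exit_trees ?r" "t \<noteq> t'" "g \<in> F t \<inter> F t'"
      have "t v = t' v" if "v \<in> verts G - {?r}" for v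
      proof -
        have "last (g v) = t v" "last (g v) = t' v"
          using * that by (auto simp: F_def dest!: PiE_mem[of _ _ _ v])
        then show ?thesis by simp
      qed
      then have "t = t'"
        using *(1,2) by (intro PiE_ext[of t _ _ t']) (auto simp: exit_trees_def)
      with *(3) show False by contradiction
    qed
  qed (rule finite_exit_trees)
  also have "\<dots> = (\<Sum>t\<in>exit_trees ?r. \<Prod>v\<in>verts G. fact (out_degree G v - 1))"
  proof (rule sum.cong)
    fix t assume t: "t \<in> exit_trees ?r"
    show "card (F t) = (\<Prod>v\<in>verts G. fact (out_degree G v - 1))"
      unfolding F_def
    proof (subst card_PiE, simp, rule prod.cong)
      fix v assume v: "v \<in> verts G"
      show "card (if v = ?r then {xs \<in> permutations_of_set (out_arcs G v). hd xs = e}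
        else {xs \<in> permutations_of_set (out_arcs G v). last xs = t v}) = fact (out_degree G v - 1)"
      proof (cases "v = ?r")
        case True
        then show ?thesis
          using card_permutations_of_set_hd[of "out_arcs G v" e] e
          by (simp add: finite_out_arcs out_degree_def)
      next
        case False
        have "t \<in> (\<Pi>\<^sub>E v\<in>verts G - {?r}. out_arcs G v)"
          using t by (simp add: exit_trees_def)
        then have "t v \<in> out_arcs G v"
          by (rule PiE_mem) (use v False in simp)
        from card_permutations_of_set_last[OF finite_out_arcs this] False show ?thesis
          by (simp only: if_False out_degree_def)
      qed
    qed simp
  qed simp
  finally show ?thesis
    by (simp add: kappa_eq_card_exit_trees)
qed

theorem card_euler_circuits:
  assumes "e \<in> arcs G" "\<And>v. v \<in> verts G \<Longrightarrow> out_arcs G v \<noteq> {}"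
    "\<And>v. v \<in> verts G \<Longrightarrow> in_degree G v = out_degree G v"
  shows "card (euler_circuits e) = kappa G (tail G e) * (\<Prod>v\<in>verts G. fact (out_degree G v - 1))"
  using bij_betw_same_card[OF bij_betw_exits[OF assms]] card_exit_orders[OF assms(1,2)] by simp
end

section \<open>Words of circuits\<close>

lemma snoc_less_snoc_iff:
  fixes xs ys :: "'a::linorder list"
  assumes "length xs = length ys"
  shows "xs @ [c] < ys @ [c] \<longleftrightarrow> xs < ys"
  using assms by (induction xs ys rule: list_induct2) auto

lemma nth_concat_equal_length:
  assumes "\<And>u. u \<in> set us \<Longrightarrow> length u = k" "i < k * length us"
  shows "concat us ! i = us ! (i div k) ! (i mod k)"
  using assms
proof (induction us arbitrary: i)
  case (Cons u us)
  show ?case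
  proof (cases "i < k")
    case True
    with Cons.prems show ?thesis by (simp add: nth_append)
  next
    case False
    then have k: "0 < k" "k \<le> i"
      using Cons.prems(2) by (auto intro: gr0I)
    from False Cons.prems have "concat us ! (i - k) = us ! ((i - k) div k) ! ((i - k) mod k)"
      by (intro Cons.IH) auto
    moreover have "i div k = Suc ((i - k) div k)" "i mod k = (i - k) mod k"
      using k by (simp_all add: le_div_geq le_mod_geq)
    ultimately show ?thesis
      using False Cons.prems(1) by (simp add: nth_append)
  qed
qed simp

lemma concat_upt_blocks: "concat (map (\<lambda>m. [k * m..<k * m + k]) [0..<n]) = [0..<k * n]"
proof (induction n)
  case (Suc n)
  then show ?case
    using upt_add_eq_append[of 0 "k * n" k] by (simp add: add.commute)
qed simp

definition db_circuits :: "nat \<Rightarrow> nat \<Rightarrow> nat list set" where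
  "db_circuits k n = {q. distinct q \<and> set q = {0..<k * n} \<and>
    (\<forall>i<k * n. q ! i mod n = q ! (Suc i mod (k * n)) div k)}"

definition circuit_word :: "nat \<Rightarrow> nat list \<Rightarrow> nat list" where
  "circuit_word n q = map (\<lambda>x. x div n) q"

lemma length_db_circuit: "q \<in> db_circuits k n \<Longrightarrow> length q = k * n"
  using distinct_card[of q] by (simp add: db_circuits_def)

lemma length_circuit_word [simp]: "length (circuit_word n q) = length q"
  by (simp add: circuit_word_def)

text \<open>From \<open>x < y\<close> and equal quotients by \<open>n\<close> follows
  \<open>x mod n < y mod n\<close>, so the successors have strictly ordered quotients by
  \<open>k\<close> and are themselves strictly ordered. The inequality thus survives every tie,
  until two letters differ or the lists end, which gives the second alternative.\<close>

lemma map_div_less_or_pointwise_less: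
  fixes xs ys :: "nat list"
  assumes "length xs = length ys"
    and "successively (\<lambda>a b. a mod n = b div k) xs" "successively (\<lambda>a b. a mod n = b div k) ys"
    and "xs \<noteq> []" "hd xs < hd ys"
  shows "map (\<lambda>x. x div n) xs < map (\<lambda>x. x div n) ys \<or> list_all2 (<) xs ys"
  using assms
proof (induction xs ys rule: list_induct2)
  case (Cons x xs y ys)
  from Cons.prems have "x < y" by simp
  then have "x div n \<le> y div n"
    by (intro div_le_mono) simp
  show ?case
  proof (cases "x div n = y div n \<and> xs \<noteq> []")
    case False
    with \<open>x < y\<close> \<open>x div n \<le> y div n\<close> Cons.hyps show ?thesis by auto
  next
    case True
    then obtain x' xs' y' ys' where *: "xs = x' # xs'" "ys = y' # ys'"
      using Cons.hyps by (metis length_0_conv list.exhaust)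
    have "x mod n < y mod n"
      using \<open>x < y\<close> True by (metis div_mult_mod_eq nat_add_left_cancel_less)
    with Cons.prems * have "x' div k < y' div k"
      by simp
    then have "x' < y'"
      using div_le_mono[of y' x' k] by (meson not_le)
    with Cons * True \<open>x < y\<close> show ?thesis by simp
  qed
qed simp

text \<open>
  Two equal rotations would keep one shifted circuit below the other over a whole period,
  although it passes through the largest number.
\<close>

lemma rotate_circuit_word_less:
  assumes q: "q \<in> db_circuits k n" and ij: "i < k * n" "j < k * n" "q ! i < q ! j"
  shows "rotate i (circuit_word n q) < rotate j (circuit_word n q)"
proof -
  let ?N = "k * n"
  have len: "length q = ?N"
    by (rule length_db_circuit[OF q])
  have succ: "successively (\<lambda>a b. a mod n = b div k) (rotate i q)" for i
    unfolding successively_conv_nth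
  proof (intro allI impI)
    fix t assume t: "Suc t < length (rotate i q)"
    then have "(i + t) mod ?N < ?N"
      using len t by (intro mod_less_divisor) (simp only: length_rotate)
    then have "q ! ((i + t) mod ?N) mod n = q ! (Suc ((i + t) mod ?N) mod ?N) div k"
      using q unfolding db_circuits_def by blast
    then show "rotate i q ! t mod n = rotate i q ! Suc t div k"
      using t len by (simp add: nth_rotate mod_Suc_eq)
  qed
  have "\<not> list_all2 (<) (rotate i q) (rotate j q)"
  proof
    assume *: "list_all2 (<) (rotate i q) (rotate j q)"
    have "?N - 1 \<in> set (rotate i q)"
      using q ij by (auto simp: db_circuits_def)
    then obtain t where t: "t < ?N" "rotate i q ! t = ?N - 1"
      using len by (metis in_set_conv_nth length_rotate)
    with * len have "?N - 1 < rotate j q ! t"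
      by (metis length_rotate list_all2_nthD)
    moreover have "rotate j q ! t \<in> set (rotate j q)"
      using t(1) len by (intro nth_mem) simp
    then have "rotate j q ! t < ?N"
      using q by (auto simp: db_circuits_def)
    ultimately show False by simp
  qed
  moreover have "q \<noteq> []"
    using ij(1) len by auto
  moreover from this have "hd (rotate i q) = q ! i" if "i < ?N" for i
    using hd_rotate_conv_nth[of q i] that len by simp
  ultimately have "map (\<lambda>x. x div n) (rotate i q) < map (\<lambda>x. x div n) (rotate j q)"
    using map_div_less_or_pointwise_less[OF _ succ[of i] succ[of j]] ij len \<open>q \<noteq> []\<close> by auto
  then show ?thesis
    by (simp add: circuit_word_def rotate_map)
qed

text \<open>Listing the rotations by increasing \<open>q ! i\<close> gives strictly increasing rows,
  by \<open>rotate_circuit_word_less\<close>; a sorted list with the right multiset is the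
  matrix.\<close>

lemma bw_matrix_circuit_word:
  assumes q: "q \<in> db_circuits k n"
  shows "distinct (bw_matrix (circuit_word n q))"
    and "i < k * n \<Longrightarrow> bw_matrix (circuit_word n q) ! (q ! i) = rotate i (circuit_word n q)"
proof -
  let ?N = "k * n" and ?w = "circuit_word n q"
  have len: "length q = ?N"
    by (rule length_db_circuit[OF q])
  have bij: "bij_betw ((!) q) {..<?N} {..<?N}"
    using q len bij_betw_nth[of q "{..<?N}" "{..<?N}"]
    by (auto simp: db_circuits_def lessThan_atLeast0)
  define idx where "idx = inv_into {..<?N} ((!) q)"
  have idx: "bij_betw idx {..<?N} {..<?N}"
    unfolding idx_def by (rule bij_betw_inv_into[OF bij])
  have q_idx: "q ! idx s = s" if "s < ?N" for s
    using bij_betw_inv_into_right[OF bij, of s] that by (simp add: idx_def)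
  have idx_q: "idx (q ! i) = i" if "i < ?N" for i
    using bij_betw_inv_into_left[OF bij, of i] that by (simp add: idx_def)
  have idx_less: "idx s < ?N" if "s < ?N" for s
    using bij_betwE[OF idx] that by auto
  let ?M = "map (\<lambda>s. rotate (idx s) ?w) [0..<?N]"
  have strict: "sorted_wrt (<) ?M"
    unfolding sorted_wrt_map
  proof (rule sorted_wrt_mono_rel)
    show "sorted_wrt (<) [0..<?N]"
      by simp
    fix s t assume "s \<in> set [0..<?N]" "t \<in> set [0..<?N]" "s < t"
    then show "rotate (idx s) ?w < rotate (idx t) ?w"
      using q_idx idx_less by (intro rotate_circuit_word_less[OF q]) auto
  qed
  have "mset (map idx [0..<?N]) = mset [0..<?N]"
    using idx by (subst set_eq_iff_mset_eq_distinct[symmetric])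
      (auto simp: distinct_map bij_betw_def lessThan_atLeast0)
  then have "image_mset (\<lambda>i. rotate i ?w) (mset (map idx [0..<?N])) = mset (map (\<lambda>i. rotate i ?w) [0..<?N])"
    by (simp only: mset_map)
  then have "mset ?M = mset (map (\<lambda>i. rotate i ?w) [0..<?N])"
    by (simp only: mset_map[symmetric] map_map comp_def)
  then have "bw_matrix ?w = ?M"
    unfolding bw_matrix_def using strict len by (intro properties_for_sort) (auto simp: strict_sorted_iff)
  then show "distinct (bw_matrix ?w)" and "i < ?N \<Longrightarrow> bw_matrix ?w ! (q ! i) = rotate i ?w"
    using strict idx_q bij_betwE[OF bij] by (auto simp: strict_sorted_iff)
qed

lemma last_rotate_Suc:
  assumes "i < length w"
  shows "last (rotate (Suc i) w) = w ! i"
proof -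
  have "w \<noteq> []"
    using assms by auto
  then show ?thesis
    using hd_rotate_conv_nth[of w i] assms by (simp add: rotate1_hd_tl)
qed

lemma BWT_circuit_word:
  assumes q: "q \<in> db_circuits k n" and i: "i < k * n"
  shows "BWT (necklace (circuit_word n q)) ! (q ! (Suc i mod (k * n))) = q ! i div n"
proof -
  let ?N = "k * n" and ?w = "circuit_word n q"
  have len: "length q = ?N"
    by (rule length_db_circuit[OF q])
  have j: "Suc i mod ?N < ?N"
    using i by (intro mod_less_divisor) linarith
  have "q ! (Suc i mod ?N) \<in> set q"
    using j len by (intro nth_mem) simp
  then have "q ! (Suc i mod ?N) < length (bw_matrix ?w)"
    using q len by (auto simp: db_circuits_def bw_matrix_def)
  then have "BWT (necklace ?w) ! (q ! (Suc i mod ?N)) = last (rotate (Suc i mod ?N) ?w)"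
    using bw_matrix_circuit_word(2)[OF q j] by (simp add: BWT_necklace)
  also have "rotate (Suc i mod ?N) ?w = rotate (Suc i) ?w"
    using rotate_conv_mod[of "Suc i" ?w] len by simp
  also have "last \<dots> = q ! i div n"
    using last_rotate_Suc[of i ?w] i len by (simp add: circuit_word_def del: rotate_Suc)
  finally show ?thesis .
qed

text \<open>Let row \<open>s\<close> be the successor of \<open>x\<close> in the circuit. Its block
  is \<open>s div k = x mod n\<close>, its last letter is \<open>x div n\<close>; together they
  determine \<open>x\<close> and hence \<open>s\<close>. So the letters within a block of
  \<open>k\<close> rows are distinct, and being below \<open>k\<close> they exhaust the
  alphabet.\<close>

lemma necklace_circuit_word_in_generalized_de_bruijn_words:
  assumes q: "q \<in> db_circuits k n"
  shows "necklace (circuit_word n q) \<in> generalized_de_bruijn_words k (k * n)"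
proof -
  let ?N = "k * n" and ?w = "circuit_word n q"
  define L where "L = BWT (necklace ?w)"
  have len: "length q = ?N"
    by (rule length_db_circuit[OF q])
  have q_set: "set q = {0..<?N}" and step: "\<And>i. i < ?N \<Longrightarrow> q ! i mod n = q ! (Suc i mod ?N) div k"
    using q by (auto simp: db_circuits_def)
  have len_L: "length L = ?N"
    using len by (simp add: L_def BWT_necklace bw_matrix_def)
  have q_less: "q ! i < ?N" if "i < ?N" for i
    using that q_set len nth_mem[of i q] by auto
  have pred: "\<exists>i<?N. s = q ! (Suc i mod ?N)" if "s < ?N" for s
  proof -
    from that q_set len obtain j where j: "j < ?N" "q ! j = s"
      by (metis atLeastLessThan_iff in_set_conv_nth zero_le)
    let ?i = "if j = 0 then ?N - 1 else j - 1"
    have "Suc ?i mod ?N = j" "?i < ?N"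
      using j(1) by auto
    with j(2) show ?thesis by metis
  qed
  have L_less: "L ! s < k" if "s < ?N" for s
  proof -
    from pred[OF that] obtain i where "i < ?N" "s = q ! (Suc i mod ?N)"
      by blast
    then show ?thesis
      using BWT_circuit_word[OF q] q_less[of i] by (simp add: L_def less_mult_imp_div_less)
  qed
  have L_inj: "s = t" if st: "s < ?N" "t < ?N" "s div k = t div k" "L ! s = L ! t" for s t
  proof -
    obtain i j where ij: "i < ?N" "s = q ! (Suc i mod ?N)" "j < ?N" "t = q ! (Suc j mod ?N)"
      using pred st(1,2) by metis
    have "q ! i mod n = q ! j mod n"
      using step ij st(3) by simp
    moreover have "q ! i div n = q ! j div n"
      using st(4) ij BWT_circuit_word[OF q] by (simp add: L_def)
    ultimately have "q ! i = q ! j"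
      by (metis div_mult_mod_eq)
    then have "i = j"
      using q len ij nth_eq_iff_index_eq[of q i j] by (simp add: db_circuits_def)
    with ij show ?thesis by simp
  qed
  define us where "us = map (\<lambda>m. map ((!) L) [k * m..<k * m + k]) [0..<n]"
  have "L = map ((!) L) [0..<?N]"
    using len_L by (metis map_nth)
  also have "\<dots> = concat us"
    by (simp add: us_def concat_upt_blocks[symmetric] map_concat comp_def)
  finally have L: "L = concat us" .
  have "distinct u \<and> set u = {0..<k}" if u_us: "u \<in> set us" for u
  proof -
    obtain m where "m \<in> {0..<n}" and u: "u = map ((!) L) [k * m..<k * m + k]"
      using u_us unfolding us_def set_map set_upt by blast
    then have m: "m < n" by simp
    have *: "s < ?N \<and> s div k = m" if "s \<in> {k * m..<k * m + k}" for s
    proof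
      have "k * m + k \<le> ?N"
        using m by (metis Suc_leI mult_Suc_right add.commute mult_le_mono2)
      with that show "s < ?N" by simp
      show "s div k = m"
        using that by (intro div_nat_eqI) (auto simp: mult.commute)
    qed
    have inj: "inj_on ((!) L) {k * m..<k * m + k}"
    proof (rule inj_onI)
      fix s t assume st: "s \<in> {k * m..<k * m + k}" "t \<in> {k * m..<k * m + k}" "L ! s = L ! t"
      show "s = t"
        using *[OF st(1)] *[OF st(2)] st(3) by (metis L_inj)
    qed
    have "set u = {0..<k}"
      unfolding u set_map set_upt
      by (rule card_subset_eq) (use * L_less card_image[OF inj] in auto)
    moreover have "distinct u"
      using inj by (simp add: u distinct_map)
    ultimately show ?thesis by simp
  qed
  moreover have "set ?w \<subseteq> {0..<k}"
    using q_set by (auto simp: circuit_word_def less_mult_imp_div_less)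
  ultimately show ?thesis
    using L len unfolding generalized_de_bruijn_words_def L_def by (intro CollectI exI[of _ ?w]) auto
qed

text \<open>Equal necklaces share one matrix with distinct rows, and the row numbers of successive
  rotations give back the circuit. Hence \<open>q'\<close> is a rotation of \<open>q\<close>, which
  equal heads and distinct entries force to be trivial.\<close>

lemma inj_on_necklace_circuit_word:
  "inj_on (\<lambda>q. necklace (circuit_word n q)) {q \<in> db_circuits k n. hd q = x}"
proof (rule inj_onI)
  fix q q' assume *: "q \<in> {q \<in> db_circuits k n. hd q = x}" "q' \<in> {q \<in> db_circuits k n. hd q = x}"
    and eq: "necklace (circuit_word n q) = necklace (circuit_word n q')"
  let ?N = "k * n" and ?w = "circuit_word n q" and ?w' = "circuit_word n q'"
  have q: "q \<in> db_circuits k n" and q': "q' \<in> db_circuits k n" and hd: "hd q = hd q'"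
    using * by auto
  have len: "length q = ?N" "length q' = ?N"
    using length_db_circuit q q' by auto
  show "q = q'"
  proof (cases "?N = 0")
    case True
    with len show ?thesis by simp
  next
    case False
    have "?w' \<in> necklace ?w'"
      unfolding necklace_def by (auto intro: exI[of _ 0])
    with eq obtain j where j: "?w' = rotate j ?w"
      by (auto simp: necklace_def)
    let ?M = "bw_matrix ?w"
    have M: "bw_matrix ?w' = ?M"
      by (simp add: j bw_matrix_rotate)
    have len_M: "length ?M = ?N"
      using len by (simp add: bw_matrix_def)
    have less: "q ! i < ?N" "q' ! i < ?N" if "i < ?N" for i
      using that len q q' nth_mem[of i q] nth_mem[of i q'] by (auto simp: db_circuits_def)
    have rot: "q' ! i = q ! ((i + j) mod ?N)" if i: "i < ?N" for i
    proof -
      have ij: "(i + j) mod ?N < ?N"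
        using False by simp
      have "?M ! (q' ! i) = rotate i ?w'"
        using bw_matrix_circuit_word(2)[OF q' i] M by simp
      also have "\<dots> = rotate ((i + j) mod ?N) ?w"
        using j len rotate_conv_mod[of "i + j" ?w] by (simp add: rotate_rotate)
      also have "\<dots> = ?M ! (q ! ((i + j) mod ?N))"
        using bw_matrix_circuit_word(2)[OF q ij] by simp
      finally show ?thesis
        using nth_eq_iff_index_eq[OF bw_matrix_circuit_word(1)[OF q]] less i ij len_M by auto
    qed
    have "q ! 0 = q ! (j mod ?N)"
      using rot[of 0] hd False len by (metis add_0 bot_nat_0.not_eq_extremum hd_conv_nth length_0_conv)
    moreover have "distinct q"
      using q by (simp add: db_circuits_def)
    ultimately have "j mod ?N = 0"
      using False len nth_eq_iff_index_eq[of q 0 "j mod ?N"] by simp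
    then have "q' ! i = q ! i" if "i < ?N" for i
      using rot[OF that] that by (metis add.right_neutral mod_add_right_eq mod_less)
    then show ?thesis
      using len by (intro nth_equalityI) auto
  qed
qed

section \<open>Circuits of words\<close>

text \<open>Each block contains \<open>c\<close> exactly once, so \<open>s div k\<close> numbers the
  occurrences of \<open>c\<close> from top to bottom.\<close>

lemma card_letters_in_permutation_blocks:
  fixes us :: "nat list list"
  assumes us: "\<And>u. u \<in> set us \<Longrightarrow> distinct u \<and> set u = {0..<k}" and L: "L = concat us"
    and c: "c < k"
  shows "card {s. s < length L \<and> L ! s = c} = length us" (is ?total)
    and "s < length L \<Longrightarrow> L ! s = c \<Longrightarrow> card {t. t < s \<and> L ! t = c} = s div k" (is "_ \<Longrightarrow> _ \<Longrightarrow> ?below")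
proof -
  have len_u: "length u = k" if "u \<in> set us" for u
    using us[OF that] distinct_card[of u] by simp
  have "sum_list (map length us) = length us * k"
    using len_u by (induction us) auto
  then have len: "length L = k * length us"
    by (simp add: L length_concat mult.commute)
  have nth: "L ! s = us ! (s div k) ! (s mod k)" if "s < length L" for s
    using nth_concat_equal_length[of us k s] len_u that len L by simp
  have div_less: "s div k < length us" if "s < length L" for s
    using that len by (simp add: less_mult_imp_div_less mult.commute)
  have inj: "s = t" if st: "s < length L" "t < length L" "s div k = t div k" "L ! s = L ! t" for s t
  proof -
    let ?u = "us ! (s div k)"
    have u: "?u \<in> set us"
      using div_less[OF st(1)] by simp
    have "?u ! (s mod k) = ?u ! (t mod k)"
      using nth[OF st(1)] nth[OF st(2)] st(3,4) by simp
    then have "s mod k = t mod k"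
      using us[OF u] len_u[OF u] c by (subst (asm) nth_eq_iff_index_eq) auto
    with st(3) show ?thesis
      by (metis div_mult_mod_eq)
  qed
  have surj: "\<exists>s. s < length L \<and> s div k = m \<and> L ! s = c" if m: "m < length us" for m
  proof -
    have "c \<in> set (us ! m)" "length (us ! m) = k"
      using us[of "us ! m"] len_u[of "us ! m"] m c by auto
    then obtain j where j: "j < k" "us ! m ! j = c"
      by (metis in_set_conv_nth)
    have d: "(k * m + j) div k = m" "(k * m + j) mod k = j"
      using j(1) by auto
    moreover have "k * m + j < length L"
    proof -
      have "k * m + j < k * Suc m"
        using j(1) by simp
      also have "\<dots> \<le> k * length us"
        using m by (intro mult_le_mono2) simp
      finally show ?thesis
        by (simp only: len)
    qed
    ultimately show ?thesis
      using nth[of "k * m + j"] j(2) by auto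
  qed
  have "bij_betw (\<lambda>s. s div k) {s. s < length L \<and> L ! s = c} {..<length us}"
    unfolding bij_betw_def
  proof (intro conjI inj_onI equalityI subsetI)
    fix m assume "m \<in> {..<length us}"
    then show "m \<in> (\<lambda>s. s div k) ` {s. s < length L \<and> L ! s = c}"
      using surj[of m] by auto
  qed (use inj div_less in auto)
  then show ?total
    using bij_betw_same_card by force
  show ?below if s: "s < length L" "L ! s = c"
  proof -
    have "bij_betw (\<lambda>t. t div k) {t. t < s \<and> L ! t = c} {..<s div k}"
      unfolding bij_betw_def
    proof (intro conjI inj_onI equalityI subsetI)
      fix x y assume "x \<in> {t. t < s \<and> L ! t = c}" "y \<in> {t. t < s \<and> L ! t = c}" "x div k = y div k"
      with s inj[of x y] show "x = y" by simp
    next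
      fix m assume "m \<in> (\<lambda>t. t div k) ` {t. t < s \<and> L ! t = c}"
      then obtain t where t: "t < s" "L ! t = c" "m = t div k"
        by blast
      have "t div k \<noteq> s div k"
        using inj[of t s] t s by auto
      moreover have "t div k \<le> s div k"
        using t(1) by (intro div_le_mono) simp
      ultimately show "m \<in> {..<s div k}"
        using t(3) by simp
    next
      fix m assume m: "m \<in> {..<s div k}"
      then have "m < length us"
        using div_less[OF s(1)] by simp
      from surj[OF this] obtain t where t: "t < length L" "t div k = m" "L ! t = c"
        by blast
      moreover have "t < s"
        using m t(2) div_le_mono[of s t k] by (metis lessThan_iff not_le)
      ultimately show "m \<in> (\<lambda>t. t div k) ` {t. t < s \<and> L ! t = c}"
        by blast
    qed
    then show ?thesis
      using bij_betw_same_card by force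
  qed
qed

lemma rotate_less_iff:
  fixes w :: "'a::linorder list"
  assumes "i < length w" "j < length w"
  shows "rotate i w < rotate j w \<longleftrightarrow>
    w ! i < w ! j \<or> w ! i = w ! j \<and> rotate (Suc i) w < rotate (Suc j) w"
proof -
  have ne: "w \<noteq> []"
    using assms by auto
  have *: "rotate t w = w ! t # tl (rotate t w)" "rotate (Suc t) w = tl (rotate t w) @ [w ! t]"
    if "t < length w" for t
    using hd_rotate_conv_nth[OF ne, of t] that ne
    by (simp_all add: rotate1_hd_tl) (metis hd_Cons_tl rotate_is_Nil_conv)
  have "length (tl (rotate i w)) = length (tl (rotate j w))"
    by simp
  from snoc_less_snoc_iff[OF this] show ?thesis
    using *(1)[OF assms(1)] *(1)[OF assms(2)] *(2)[OF assms(1)] *(2)[OF assms(2)]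
    by (metis Cons_less_Cons)
qed

text \<open>
  The first column of the matrix is sorted and contains each letter \<open>n\<close> times, so the row of
  \<open>rotate i w\<close> is \<open>n * w ! i\<close> plus the number of rotations with first letter \<open>w ! i\<close> that are
  smaller. Moving this letter to the end, the latter become the rows above that of
  \<open>rotate (Suc i) w\<close> which end with \<open>w ! i\<close>, one for each complete block of the last column.
\<close>

lemma generalized_de_bruijn_word_circuit:
  assumes k: "k \<ge> 2" and n: "n \<ge> 1"
    and w: "length w = k * n" "set w \<subseteq> {0..<k}"
    and L: "BWT (necklace w) = concat us" and us: "\<And>u. u \<in> set us \<Longrightarrow> distinct u \<and> set u = {0..<k}"
  shows "\<exists>q\<in>db_circuits k n. circuit_word n q = w"
proof -
  let ?N = "k * n"
  define M where "M = bw_matrix w"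
  define R where "R = (\<lambda>i. rotate i w)"
  define L where "L = map last M"
  have L_us: "L = concat us"
    using L by (simp add: L_def M_def BWT_necklace)
  have N: "2 \<le> ?N"
    using k n by (metis mult_le_mono nat_mult_1_right)
  have len: "length M = ?N" "length L = ?N"
    by (simp_all add: M_def L_def bw_matrix_def w)
  have len_u: "length u = k" if "u \<in> set us" for u
    using us[OF that] distinct_card[of u] by simp
  have "sum_list (map length us) = length us * k"
    using len_u by (induction us) auto
  then have "length us * k = k * n"
    using len(2) L_us by (simp add: length_concat)
  then have len_us: "length us = n"
    using k by simp
  have sorted_M: "sorted M" and mset_M: "mset M = mset (map R [0..<?N])"
    by (simp_all add: M_def bw_matrix_def R_def w)
  have R_mod: "R (i mod ?N) = R i" for i
    using rotate_conv_mod[of i w] w by (simp add: R_def)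
  \<comment> \<open>Equal rotations give \<open>w\<close> a proper cyclic period, so every row
    occurs at least twice. For the least row this puts the same letter twice at the top of the last
    column, inside the first block since \<open>k \<ge> 2\<close>.\<close>
  have R_inj: "inj_on R {..<?N}"
  proof (rule linorder_inj_onI')
    fix i j assume ij: "i \<in> {..<?N}" "j \<in> {..<?N}" "i < j"
    show "R i \<noteq> R j"
    proof
      assume eq: "R i = R j"
      obtain x M' where M: "M = x # M'"
        using len N by (cases M) auto
      have "x \<in># mset (map R [0..<?N])"
        unfolding mset_M[symmetric] M by simp
      then obtain t where t: "t < ?N" "x = R t"
        by auto
      \<comment> \<open>Rotating the two equal rows further shows that row \<open>t\<close>
        reappears after \<open>j - i\<close> steps; adding \<open>?N\<close> keeps the natural
        subtraction of \<open>i\<close> exact.\<close>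
      have "R (t + ?N) = rotate (t + ?N - i) (R i)" "R (t + ?N + (j - i)) = rotate (t + ?N - i) (R j)"
        using ij by (simp_all add: R_def rotate_rotate)
      with eq have "R (t + ?N) = R (t + ?N + (j - i))"
        by simp
      then have "R t = R ((t + (j - i)) mod ?N)"
        using R_mod[of "t + ?N"] R_mod[of "t + ?N + (j - i)"] t(1)
        by (metis add.assoc add.commute mod_add_self2 mod_less)
      moreover have "(t + (j - i)) mod ?N \<noteq> t"
        using ij t(1) by (auto simp: mod_if)
      moreover define t' where "t' = (t + (j - i)) mod ?N"
      moreover have "t' < ?N"
        using N unfolding t'_def by (intro mod_less_divisor) linarith
      ultimately have t': "t' \<in> {0..<?N} - {t}" "R t' = x"
        using t(2) by auto
      have "mset_set {0..<?N} = add_mset t (add_mset t' (mset_set ({0..<?N} - {t} - {t'})))"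
        using t(1) t'(1) mset_set.remove[of "{0..<?N}" t] mset_set.remove[of "{0..<?N} - {t}" t'] by simp
      then have "mset M = add_mset x (add_mset x (image_mset R (mset_set ({0..<?N} - {t} - {t'}))))"
        using mset_M t(2) t'(2) by simp
      then have "x \<in> set M'"
        by (metis M add_mset_add_mset_same_iff mset.simps(2) set_mset_mset union_single_eq_member)
      with sorted_M M obtain M'' where M'': "M' = x # M''"
        by (cases M') auto
      obtain u us' where us': "us = u # us'"
        using len_us n by (cases us) auto
      obtain a u' where "u = a # u'" "length u' = k - 1"
        using len_u[of u] us' k by (cases u) auto
      then obtain b u'' where u: "u = a # b # u''"
        using k by (cases u') auto
      have "a = last x" "b = last x"
        using L_us unfolding L_def M M'' us' u by simp_all
      with us[of u] us' u show False
        by simp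
    qed
  qed
  have distinct_M: "distinct M"
    using mset_eq_imp_distinct_iff[OF mset_M] R_inj by (simp add: distinct_map lessThan_atLeast0)
  have set_M: "set M = R ` {..<?N}"
    using mset_eq_setD[OF mset_M] by (simp add: lessThan_atLeast0)
  \<comment> \<open>The row of rotation \<open>i\<close>, well defined as the rows are distinct. The
    sequence of these rows is the circuit sought.\<close>
  define pos where "pos = (\<lambda>i. inv_into {..<?N} ((!) M) (R i))"
  have bij_M: "bij_betw ((!) M) {..<?N} (R ` {..<?N})"
    using bij_betw_nth[OF distinct_M] len set_M by simp
  have bij_pos: "bij_betw pos {..<?N} {..<?N}"
    using bij_betw_trans[OF inj_on_imp_bij_betw[OF R_inj] bij_betw_inv_into[OF bij_M]]
    by (simp add: pos_def comp_def)
  have M_pos: "M ! pos i = R i" if "i < ?N" for i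
    using bij_betw_inv_into_right[OF bij_M] that by (simp add: pos_def)
  have pos_less: "pos i < ?N" if "i < ?N" for i
    using bij_betwE[OF bij_pos] that by simp
  have strict_M: "sorted_wrt (<) M"
    using sorted_M distinct_M by (simp add: strict_sorted_iff)
  have pos_less_iff: "pos i < pos j \<longleftrightarrow> R i < R j" if "i < ?N" "j < ?N" for i j
  proof -
    have *: "M ! s < M ! t" if "s < t" "t < ?N" for s t
      using sorted_wrt_nth_less[OF strict_M that(1)] that(2) len by simp
    show ?thesis
      using *[of "pos i" "pos j"] *[of "pos j" "pos i"] M_pos pos_less that
      by (metis linorder_neqE_nat order_less_asym order_less_irrefl)
  qed
  define nx where "nx = (\<lambda>i. pos (Suc i mod ?N))"
  have Suc_less: "Suc i mod ?N < ?N" for i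
    using N by (intro mod_less_divisor) linarith
  have "bij_betw (\<lambda>i. Suc i mod ?N) {..<?N} {..<?N}"
    unfolding bij_betw_def
  proof
    show inj: "inj_on (\<lambda>i. Suc i mod ?N) {..<?N}"
      by (intro inj_onI) (auto simp: mod_Suc split: if_splits)
    show "(\<lambda>i. Suc i mod ?N) ` {..<?N} = {..<?N}"
      using Suc_less inj by (intro endo_inj_surj) auto
  qed
  from bij_betw_trans[OF this bij_pos] have bij_nx: "bij_betw nx {..<?N} {..<?N}"
    by (simp add: nx_def comp_def)
  have nx_less: "nx i < ?N" if "i < ?N" for i
    using pos_less[OF Suc_less] by (simp add: nx_def)
  have L_nx: "L ! nx i = w ! i" if "i < ?N" for i
  proof -
    have "L ! nx i = last (R (Suc i))"
      using M_pos[OF Suc_less[of i]] pos_less[OF Suc_less[of i]] len R_mod by (simp add: L_def nx_def)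
    then show ?thesis
      using last_rotate_Suc[of i w] that w by (simp add: R_def del: rotate_Suc)
  qed
  have w_less: "w ! i < k" if "i < ?N" for i
    using w that nth_mem[of i w] by (simp add: subset_iff)
  have main: "pos i = n * w ! i + nx i div k" if i: "i < ?N" for i
  proof -
    let ?c = "w ! i"
    let ?A = "{j. j < ?N \<and> w ! j < ?c}" and ?B = "{j. j < ?N \<and> w ! j = ?c \<and> nx j < nx i}"
    have "pos i = card {..<pos i}"
      by simp
    also have "{..<pos i} = pos ` {j. j < ?N \<and> pos j < pos i}"
    proof (intro equalityI subsetI)
      fix s assume s: "s \<in> {..<pos i}"
      with pos_less[OF i] have "s \<in> {..<?N}" by simp
      with bij_pos obtain j where "j < ?N" "s = pos j"
        by (auto simp: bij_betw_def)
      with s show "s \<in> pos ` {j. j < ?N \<and> pos j < pos i}"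
        by auto
    qed auto
    also have "card \<dots> = card {j. j < ?N \<and> pos j < pos i}"
      by (intro card_image inj_on_subset[OF bij_betw_imp_inj_on[OF bij_pos]]) auto
    also have "{j. j < ?N \<and> pos j < pos i} = ?A \<union> ?B"
      using pos_less_iff rotate_less_iff[of _ w i] i w R_mod Suc_less
      unfolding nx_def R_def by auto
    also have "card \<dots> = card ?A + card ?B"
      by (rule card_Un_disjoint) auto
    \<comment> \<open>\<open>nx\<close> carries positions of \<open>w\<close> to rows of the last
      column, where \<open>L ! nx j = w ! j\<close>, so letters of \<open>w\<close> can be counted
      block by block.\<close>
    also have "card ?A = card (nx ` ?A)"
      by (intro card_image[symmetric] inj_on_subset[OF bij_betw_imp_inj_on[OF bij_nx]]) auto
    also have "nx ` ?A = (\<Union>c<?c. {s. s < length L \<and> L ! s = c})"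
    proof (intro equalityI subsetI)
      fix s assume "s \<in> nx ` ?A"
      then show "s \<in> (\<Union>c<?c. {s. s < length L \<and> L ! s = c})"
        using L_nx bij_betwE[OF bij_nx] len by auto
    next
      fix s assume s: "s \<in> (\<Union>c<?c. {s. s < length L \<and> L ! s = c})"
      then have "s \<in> {..<?N}"
        using len by auto
      with bij_nx obtain j where "j < ?N" "s = nx j"
        by (auto simp: bij_betw_def)
      with s L_nx show "s \<in> nx ` ?A"
        by auto
    qed
    also have "card \<dots> = (\<Sum>c<?c. card {s. s < length L \<and> L ! s = c})"
      by (rule card_UN_disjoint) auto
    also have "\<dots> = (\<Sum>c<?c. n)"
      using card_letters_in_permutation_blocks(1)[OF us L_us] w_less[OF i] len_us
      by (intro sum.cong) auto
    also have "card ?B = card (nx ` ?B)"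
      by (intro card_image[symmetric] inj_on_subset[OF bij_betw_imp_inj_on[OF bij_nx]]) auto
    also have "nx ` ?B = {t. t < nx i \<and> L ! t = ?c}"
    proof (intro equalityI subsetI)
      fix t assume "t \<in> nx ` ?B"
      then show "t \<in> {t. t < nx i \<and> L ! t = ?c}"
        using L_nx by auto
    next
      fix t assume t: "t \<in> {t. t < nx i \<and> L ! t = ?c}"
      then have "t \<in> {..<?N}"
        using nx_less[OF i] by simp
      with bij_nx obtain j where "j < ?N" "t = nx j"
        by (auto simp: bij_betw_def)
      with t L_nx show "t \<in> nx ` ?B"
        by auto
    qed
    also have "card \<dots> = nx i div k"
      using nx_less[OF i] L_nx[OF i] len w_less[OF i]
      by (intro card_letters_in_permutation_blocks(2)[OF us L_us]) auto
    finally show ?thesis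
      by (simp add: mult.commute)
  qed
  \<comment> \<open>With this bound, \<open>main\<close> is the division of \<open>pos i\<close> by
    \<open>n\<close>: the quotient is the letter, and the remainder is the tail of the next
    arc.\<close>
  have nx_div: "nx i div k < n" if "i < ?N" for i
    using nx_less[OF that] by (simp add: less_mult_imp_div_less mult.commute)
  let ?q = "map pos [0..<?N]"
  have "?q \<in> db_circuits k n"
    unfolding db_circuits_def
  proof (intro CollectI conjI allI impI)
    show "distinct ?q" "set ?q = {0..<?N}"
      using bij_pos by (auto simp: distinct_map bij_betw_def lessThan_atLeast0)
    fix i assume i: "i < ?N"
    then show "?q ! i mod n = ?q ! (Suc i mod ?N) div k"
      using main[OF i] nx_div[OF i] Suc_less[of i] by (simp add: nx_def)
  qed
  moreover have "circuit_word n ?q = w"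
    using main nx_div w n by (intro nth_equalityI) (auto simp: circuit_word_def)
  ultimately show ?thesis by blast
qed

section \<open>Circuits of the de Bruijn graph\<close>

lemma (in pre_digraph) cas_iff_successively:
  "p \<noteq> [] \<Longrightarrow> cas u p v \<longleftrightarrow> tail G (hd p) = u \<and> head G (last p) = v \<and>
    successively (\<lambda>a b. head G a = tail G b) p"
proof (induction p arbitrary: u)
  case (Cons a p)
  show ?case
  proof (cases "p = []")
    case False
    then have "cas (head G a) p v \<longleftrightarrow> head G a = tail G (hd p) \<and> head G (last p) = v \<and>
        successively (\<lambda>a b. head G a = tail G b) p"
      using Cons.IH[of "head G a"] by metis
    with False show ?thesis
      by (simp only: cas.simps list.sel last.simps if_False successively_Cons) blast
  qed simp
qed simp

text \<open>Indices modulo the length absorb the closing of the walk into the adjacency condition,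
  which is the form used in \<open>db_circuits\<close>.\<close>

lemma (in pre_digraph) closed_cas_iff_nth:
  assumes "p \<noteq> []"
  shows "cas (tail G (hd p)) p (tail G (hd p)) \<longleftrightarrow>
    (\<forall>i<length p. head G (p ! i) = tail G (p ! (Suc i mod length p)))"
proof -
  obtain m where m: "length p = Suc m"
    using assms by (cases p) auto
  have *: "Suc i mod Suc m = (if i = m then 0 else Suc i)" if "i < Suc m" for i
    using that by auto
  have "(\<forall>i<Suc m. head G (p ! i) = tail G (p ! (Suc i mod Suc m))) \<longleftrightarrow>
    head G (p ! m) = tail G (p ! 0) \<and> (\<forall>i<m. head G (p ! i) = tail G (p ! Suc i))"
    using * by (auto simp: less_Suc_eq)
  then show ?thesis
    using assms m by (simp add: cas_iff_successively successively_conv_nth last_conv_nth hd_conv_nth)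
qed

lemma bij_betw_filter:
  "bij_betw f A B \<Longrightarrow> bij_betw f {a \<in> A. P (f a)} {b \<in> B. P b}"
  by (auto simp: bij_betw_def inj_on_def)

lemma necklace_rotate: "necklace (rotate j w) = necklace w"
proof (intro equalityI subsetI)
  fix v assume "v \<in> necklace w"
  then obtain i where i: "v = rotate i w"
    by (auto simp: necklace_def)
  \<comment> \<open>Rotation by \<open>j\<close> is undone by \<open>j * (length w - 1)\<close>
    further steps, as both make \<open>j\<close> full turns; this works for \<open>j\<close> beyond
    the length too.\<close>
  have "rotate i w = rotate (i + j * length w) w"
    using rotate_conv_mod[of i w] rotate_conv_mod[of "i + j * length w" w] by simp
  also have "i + j * length w = (i + j * (length w - 1)) + j" if "length w \<noteq> 0"
    using that by (cases "length w") auto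
  then have "rotate (i + j * length w) w = rotate (i + j * (length w - 1)) (rotate j w)"
    by (cases "length w = 0") (simp_all add: rotate_rotate add.assoc)
  finally show "v \<in> necklace (rotate j w)"
    unfolding i necklace_def by blast
qed (auto simp: necklace_def rotate_rotate)

context
  fixes k n :: nat
  assumes k: "k \<ge> 2" and n: "n \<ge> 1"
begin

lemma fin_digraph_DB: "fin_digraph (DB k n)"
  by unfold_locales (use n in \<open>auto simp: DB_def\<close>)

lemma bij_betw_arc_number: "bij_betw (\<lambda>(m, i). k * m + i) (arcs (DB k n)) {0..<k * n}"
proof (rule bij_betwI[where g = "\<lambda>x. (x div k, x mod k)"])
  have "k * m + i < k * n" if "m < n" "i < k" for m i
  proof -
    have "k * m + i < k * Suc m"
      using that by simp
    also have "\<dots> \<le> k * n"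
      using that by (intro mult_le_mono2) simp
    finally show ?thesis .
  qed
  then show "(\<lambda>(m, i). k * m + i) \<in> arcs (DB k n) \<rightarrow> {0..<k * n}"
    by (auto simp: DB_def)
  show "(\<lambda>x. (x div k, x mod k)) \<in> {0..<k * n} \<rightarrow> arcs (DB k n)"
    using k by (auto simp: DB_def less_mult_imp_div_less mult.commute)
qed (auto simp: DB_def)

lemma out_degree_DB:
  assumes "v < n"
  shows "out_degree (DB k n) v = k"
proof -
  have "out_arcs (DB k n) v = {v} \<times> {0..<k}"
    using assms by (auto simp: out_arcs_def DB_def)
  then show ?thesis
    by (simp add: out_degree_def)
qed

text \<open>The head of an arc is its number modulo \<open>n\<close>, and the numbers below
  \<open>k * n\<close> meet each residue class \<open>k\<close> times.\<close>

lemma in_degree_DB: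
  assumes "v < n"
  shows "in_degree (DB k n) v = k"
proof -
  have "in_arcs (DB k n) v = {a \<in> arcs (DB k n). (case a of (m, i) \<Rightarrow> k * m + i) mod n = v}"
    by (auto simp: in_arcs_def DB_def)
  also have "card \<dots> = card {x \<in> {0..<k * n}. x mod n = v}"
  proof (rule bij_betw_same_card)
    show "bij_betw (\<lambda>(m, i). k * m + i) {a \<in> arcs (DB k n). (case a of (m, i) \<Rightarrow> k * m + i) mod n = v}
      {x \<in> {0..<k * n}. x mod n = v}"
      by (rule bij_betw_filter[OF bij_betw_arc_number])
  qed
  also have "\<dots> = card {0..<k}"
  proof (rule bij_betw_same_card, rule bij_betwI[where g = "\<lambda>c. c * n + v"])
    show "(\<lambda>x. x div n) \<in> {x \<in> {0..<k * n}. x mod n = v} \<rightarrow> {0..<k}"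
      by (auto simp: less_mult_imp_div_less)
    show "(\<lambda>c. c * n + v) \<in> {0..<k} \<rightarrow> {x \<in> {0..<k * n}. x mod n = v}"
    proof
      fix c assume "c \<in> {0..<k}"
      then have "c * n + v < Suc c * n" "Suc c * n \<le> k * n"
        using assms by (simp, intro mult_le_mono1) simp
      then show "c * n + v \<in> {x \<in> {0..<k * n}. x mod n = v}"
        using assms by simp
    qed
  qed (use assms in auto)
  finally show ?thesis
    by (simp add: in_degree_def)
qed

text \<open>Numbering the arcs turns adjacency into \<open>x mod n = y div k\<close>;
  \<open>k * r\<close> is the number of the starting arc \<open>(r, 0)\<close>.\<close>

lemma card_euler_circuits_DB:
  assumes r: "r < n"
  shows "card (fin_digraph.euler_circuits (DB k n) (r, 0)) = card {q \<in> db_circuits k n. hd q = k * r}"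
proof -
  interpret fin_digraph "DB k n"
    by (rule fin_digraph_DB)
  let ?f = "\<lambda>(m, i). k * m + i" and ?g = "\<lambda>x. (x div k, x mod k)"
  let ?N = "k * n"
  have f: "inj_on ?f (arcs (DB k n))" "?f ` arcs (DB k n) = {0..<?N}"
    using bij_betw_arc_number by (auto simp: bij_betw_def)
  have card_arcs: "card (arcs (DB k n)) = ?N"
    by (simp add: DB_def)
  have f_div: "?f a div k = tail (DB k n) a" and f_mod: "?f a mod n = head (DB k n) a"
    if "a \<in> arcs (DB k n)" for a
    using that by (auto simp: DB_def)
  have verts: "verts (DB k n) = {0..<n}"
    by (simp add: DB_def)
  have r_arc: "(r, 0) \<in> arcs (DB k n)"
    using r k by (simp add: DB_def)
  have tail_r: "tail (DB k n) (r, 0) = r" and f_r: "?f (r, 0) = k * r"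
    by (simp_all add: DB_def)
  have N: "?N > 0"
    using k n by simp
  have circ: "p \<in> euler_circuits (r, 0) \<longleftrightarrow>
      map ?f p \<in> db_circuits k n \<and> hd (map ?f p) = k * r" if p: "set p \<subseteq> arcs (DB k n)" for p
  proof (cases "distinct p \<and> set p = arcs (DB k n)")
    case True
    then have len: "length p = ?N"
      using distinct_card[of p] card_arcs by simp
    with N have ne: "p \<noteq> []" by auto
    have nth: "p ! i \<in> arcs (DB k n)" if "i < ?N" for i
      using True len that nth_mem[of i p] by auto
    have "hd (map ?f p) = k * r \<longleftrightarrow> hd p = (r, 0)"
      using f(1) True ne r_arc f_r by (metis hd_in_set hd_map inj_onD)
    moreover have "distinct (map ?f p)" "set (map ?f p) = {0..<?N}"
      using True f by (simp_all add: distinct_map)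
    moreover have "(\<forall>i<?N. map ?f p ! i mod n = map ?f p ! (Suc i mod ?N) div k) \<longleftrightarrow>
        cas (tail (DB k n) (hd p)) p (tail (DB k n) (hd p))"
    proof -
      have "map ?f p ! i mod n = map ?f p ! (Suc i mod ?N) div k \<longleftrightarrow>
          head (DB k n) (p ! i) = tail (DB k n) (p ! (Suc i mod ?N))" if "i < ?N" for i
      proof -
        have "Suc i mod ?N < ?N"
          using N by (rule mod_less_divisor)
        then show ?thesis
          using nth[OF that] nth[of "Suc i mod ?N"] f_div f_mod len that by simp
      qed
      then show ?thesis
        using closed_cas_iff_nth[OF ne] len by simp
    qed
    ultimately have "map ?f p \<in> db_circuits k n \<and> hd (map ?f p) = k * r \<longleftrightarrow>
        cas (tail (DB k n) (hd p)) p (tail (DB k n) (hd p)) \<and> hd p = (r, 0)"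
      unfolding db_circuits_def by blast
    also have "\<dots> \<longleftrightarrow> cas r p r \<and> hd p = (r, 0)"
      using tail_r by metis
    also have "\<dots> \<longleftrightarrow> p \<in> euler_circuits (r, 0)"
      using True r unfolding euler_circuits_def trail_def awalk_def tail_r by (simp add: verts)
    finally show ?thesis
      by blast
  next
    case False
    have "\<not> (distinct (map ?f p) \<and> set (map ?f p) = {0..<?N})"
    proof
      assume *: "distinct (map ?f p) \<and> set (map ?f p) = {0..<?N}"
      then have "?f ` set p = ?f ` arcs (DB k n)"
        by (simp only: set_map f(2))
      then have "set p = arcs (DB k n)"
        by (simp only: inj_on_image_eq_iff[OF f(1) p order_refl])
      with * False show False
        unfolding distinct_map by blast
    qed
    with False show ?thesis
      by (auto simp: db_circuits_def euler_circuits_def trail_def)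
  qed
  have "bij_betw (map ?f) (euler_circuits (r, 0)) {q \<in> db_circuits k n. hd q = k * r}"
  proof (rule bij_betwI[where g = "map ?g"])
    show "map ?f \<in> euler_circuits (r, 0) \<rightarrow> {q \<in> db_circuits k n. hd q = k * r}"
      using circ by (auto simp: euler_circuits_def)
    have *: "map ?f (map ?g q) = q" for q
      by (induction q) auto
    show "map ?g \<in> {q \<in> db_circuits k n. hd q = k * r} \<rightarrow> euler_circuits (r, 0)"
    proof
      fix q assume q: "q \<in> {q \<in> db_circuits k n. hd q = k * r}"
      then have "set (map ?g q) \<subseteq> arcs (DB k n)"
        using k by (auto simp: db_circuits_def DB_def less_mult_imp_div_less mult.commute)
      from circ[OF this] q * show "map ?g q \<in> euler_circuits (r, 0)"
        by simp
    qed
    show "map ?f (map ?g q) = q" if "q \<in> {q \<in> db_circuits k n. hd q = k * r}" for q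
      by (rule *)
    show "map ?g (map ?f p) = p" if "p \<in> euler_circuits (r, 0)" for p
    proof -
      have "set p = arcs (DB k n)"
        using that by (simp add: euler_circuits_def)
      then show ?thesis
        by (auto simp: DB_def intro!: map_idI)
    qed
  qed
  then show ?thesis
    by (rule bij_betw_same_card)
qed

lemma rotate_db_circuit:
  assumes q: "q \<in> db_circuits k n"
  shows "rotate j q \<in> db_circuits k n"
proof -
  let ?N = "k * n"
  have len: "length q = ?N"
    by (rule length_db_circuit[OF q])
  have "rotate j q ! i mod n = rotate j q ! (Suc i mod ?N) div k" if i: "i < ?N" for i
  proof -
    have N: "0 < ?N"
      using i by linarith
    then have "(j + i) mod ?N < ?N"
      by (rule mod_less_divisor)
    then have "q ! ((j + i) mod ?N) mod n = q ! (Suc ((j + i) mod ?N) mod ?N) div k"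
      using q by (simp add: db_circuits_def)
    moreover have "Suc ((j + i) mod ?N) mod ?N = (j + Suc i mod ?N) mod ?N"
      by (simp add: mod_simps)
    moreover have "Suc i mod ?N < ?N"
      using N by (rule mod_less_divisor)
    ultimately show ?thesis
      using i len by (simp add: nth_rotate)
  qed
  with q show ?thesis
    by (simp add: db_circuits_def)
qed

text \<open>Rotating a circuit does not change its necklace, and a circuit passes through
  \<open>x\<close> exactly once, so prescribing the head selects one circuit for each
  necklace.\<close>

lemma DBW_eq_card_db_circuits:
  assumes x: "x < k * n"
  shows "DBW k (k * n) = card {q \<in> db_circuits k n. hd q = x}"
proof -
  let ?C = "{q \<in> db_circuits k n. hd q = x}"
  have "generalized_de_bruijn_words k (k * n) = (\<lambda>q. necklace (circuit_word n q)) ` ?C"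
  proof (intro equalityI subsetI)
    fix W assume "W \<in> generalized_de_bruijn_words k (k * n)"
    then obtain w us where w: "W = necklace w" "length w = k * n" "set w \<subseteq> {0..<k}"
      "BWT (necklace w) = concat us" "\<And>u. u \<in> set us \<Longrightarrow> distinct u \<and> set u = {0..<k}"
      unfolding generalized_de_bruijn_words_def by blast
    from generalized_de_bruijn_word_circuit[OF k n w(2-5)] obtain q
      where q: "q \<in> db_circuits k n" "circuit_word n q = w"
      by blast
    have len: "length q = k * n"
      by (rule length_db_circuit[OF q(1)])
    have "x \<in> set q"
      using q(1) x by (simp add: db_circuits_def)
    then obtain j where j: "j < k * n" "q ! j = x"
      using len by (metis in_set_conv_nth)
    have "q \<noteq> []"
      using j len by auto
    then have "hd (rotate j q) = x"
      using hd_rotate_conv_nth[of q j] j len by simp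
    moreover have "necklace (circuit_word n (rotate j q)) = W"
      using necklace_rotate[of j "circuit_word n q"] q(2) w(1)
      by (simp add: circuit_word_def rotate_map)
    ultimately show "W \<in> (\<lambda>q. necklace (circuit_word n q)) ` ?C"
      using rotate_db_circuit[OF q(1)] by blast
  qed (use necklace_circuit_word_in_generalized_de_bruijn_words in blast)
  then show ?thesis
    using card_image[OF inj_on_necklace_circuit_word] by (simp add: DBW_def)
qed

end

theorem theorem12:
  fixes k n r :: nat
  assumes "k \<ge> 2" and "n \<ge> 1"
    and "r \<in> verts (DB k n)"
  shows "DBW k (k * n) = fact (k - 1) ^ n * kappa (DB k n) r"
proof -
  interpret fin_digraph "DB k n"
    by (rule fin_digraph_DB[OF assms(1,2)])
  have r: "r < n"
    using assms(3) by (simp add: DB_def)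
  have verts: "verts (DB k n) = {0..<n}"
    by (simp add: DB_def)
  have "k * r < k * n"
    using r assms(1) by simp
  then have "DBW k (k * n) = card {q \<in> db_circuits k n. hd q = k * r}"
    by (rule DBW_eq_card_db_circuits[OF assms(1,2)])
  also have "\<dots> = card (euler_circuits (r, 0))"
    using card_euler_circuits_DB[OF assms(1,2) r] by simp
  also have "\<dots> = kappa (DB k n) (tail (DB k n) (r, 0)) * (\<Prod>v\<in>verts (DB k n). fact (out_degree (DB k n) v - 1))"
  proof (rule card_euler_circuits)
    show "(r, 0) \<in> arcs (DB k n)"
      using r assms(1) by (simp add: DB_def)
    fix v assume "v \<in> verts (DB k n)"
    then have v: "v < n"
      by (simp add: verts)
    show "in_degree (DB k n) v = out_degree (DB k n) v"
      using in_degree_DB[OF assms(1,2) v] out_degree_DB[OF assms(1,2) v] by simp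
    show "out_arcs (DB k n) v \<noteq> {}"
      using out_degree_DB[OF assms(1,2) v] assms(1) by (auto simp: out_degree_def)
  qed
  also have "(\<Prod>v\<in>verts (DB k n). fact (out_degree (DB k n) v - 1)) = (\<Prod>v\<in>{0..<n}. fact (k - 1))"
    unfolding verts using out_degree_DB[OF assms(1,2)] by (intro prod.cong) auto
  finally show ?thesis
    by (simp add: DB_def mult.commute)
qed

end
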